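(* For every integer $t\ge 1$, the ladder $L_t$ is an exact $5$-leaf power if and only if $t\le 2$.
   Context: Graphs are finite, simple, undirected. A graph $G$ is an exact $k$-leaf power if there is a tree $T$ whose leaf set is $V(G)$ such that for distinct $u,v\in V(G)$, $uv\in E(G)$ if and only if $\operatorname{dist}_T(u,v)=k$. For $t\ge1$, the ladder $L_t$ is the bipartite graph with parts $\{x_0,\ldots,x_t\}$ and $\{y_0,\ldots,y_t\}$ in which $x_iy_j$ is an edge if and only if $|i-j|\le1$. (Equivalently, $L_t\cong P_{t+1}\square K_2$, where $P_{t+1}$ is the path on $t+1$ vertices.) *)

theory Defs
  imports "Graph_Theory.Graph_Theory" "HOL-Library.Infinite_Typeclass"
begin

text \<open>
  As in the library, a finite simple undirected graph is a symmetric loopfree finite digraph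
  without parallel arcs (\<^locale>\<open>pair_graph\<close>); an edge \<open>uv\<close> is the pair of arcs \<open>(u, v)\<close> and \<open>(v, u)\<close>.
  The library's notion \<^const>\<open>tree\<close> is unusable for these: it forbids every
  directed cycle, including the 2-cycle \<open>u, v, u\<close> that each undirected edge gives rise to.
  The cycles of an undirected graph are the directed cycles of length at least 3.
\<close>

definition undirected_tree :: "'a pair_pre_digraph \<Rightarrow> bool" where
  "undirected_tree T \<longleftrightarrow>
     pair_graph T \<and> connected (with_proj T) \<and>
     \<not> (\<exists>p. pre_digraph.cycle (with_proj T) p \<and> length p \<ge> 3)"

definition leaves :: "'a pair_pre_digraph \<Rightarrow> 'a set" where
  "leaves T = {v \<in> pverts T. out_degree (with_proj T) v = 1}"

text \<open>Every arc has cost 1; the value is \<open>\<infinity>\<close> if \<open>v\<close> is not reachable from \<open>u\<close>.\<close>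

definition graph_dist :: "'a pair_pre_digraph \<Rightarrow> 'a \<Rightarrow> 'a \<Rightarrow> ereal" where
  "graph_dist G u v = wf_digraph.\<mu> (with_proj G) (\<lambda>_. 1) u v"

text \<open>
  The tree has the same vertex type as the graph, so that its leaves can literally be the vertices
  of the graph. The type is required to be infinite so that there are always enough elements left
  for the inner vertices; then every finite tree whose leaf set is the vertex set of \<open>G\<close> has an
  isomorphic copy over this type with the same leaves.
\<close>

definition exact_leaf_power :: "nat \<Rightarrow> 'a::infinite pair_pre_digraph \<Rightarrow> bool" where
  "exact_leaf_power k G \<longleftrightarrow>
     (\<exists>T :: 'a pair_pre_digraph. undirected_tree T \<and> leaves T = pverts G \<and>
        (\<forall>u \<in> pverts G. \<forall>v \<in> pverts G. u \<noteq> v \<longrightarrow>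
           ((u, v) \<in> parcs G \<longleftrightarrow> graph_dist T u v = ereal (real k))))"

instance sum :: (infinite, type) infinite
  by intro_classes (simp add: infinite_UNIV)

text \<open>The vertex \<open>x\<^sub>i\<close> is \<^term>\<open>Inl i\<close> and \<open>y\<^sub>j\<close> is \<^term>\<open>Inr j\<close>.\<close>

definition ladder :: "nat \<Rightarrow> (nat + nat) pair_pre_digraph" where
  "ladder t =
     \<lparr> pverts = Inl ` {0..t} \<union> Inr ` {0..t},
       parcs = {(Inl i, Inr j) | i j. i \<le> t \<and> j \<le> t \<and> \<bar>int i - int j\<bar> \<le> 1}
             \<union> {(Inr j, Inl i) | i j. i \<le> t \<and> j \<le> t \<and> \<bar>int i - int j\<bar> \<le> 1} \<rparr>"

lemma pair_graph_ladder: "pair_graph (ladder t)"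
proof -
  have "parcs (ladder t) \<subseteq> pverts (ladder t) \<times> pverts (ladder t)"
    by (auto simp: ladder_def)
  moreover have "finite (pverts (ladder t))"
    by (simp add: ladder_def)
  ultimately have "finite (parcs (ladder t))"
    by (meson finite_SigmaI finite_subset)
  then show ?thesis
    by unfold_locales (auto simp: ladder_def symmetric_def sym_def)
qed

end

theory Submission
  imports Defs
begin

text \<open>
  Why ladders fail from \<open>t = 3\<close> on. Distances in a tree satisfy three conditions: among the three
  sums \<open>d u v + d w z\<close>, \<open>d u w + d v z\<close>, \<open>d u z + d v w\<close> the two largest are equal (the four-point
  condition), \<open>d u v + d v w + d u w\<close> is even (trees are bipartite), and
  \<open>d u w + 2 \<le> d v u + d v w\<close> for leaves (the path from \<open>u\<close> to \<open>w\<close> avoids \<open>v\<close> and can be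
  joined to it only through its neighbour). These are collected in \<open>leaf_metric\<close>, and they leave
  almost no freedom for a ladder with \<open>d = 5\<close> on its edges. Call the distance of two consecutive
  vertices on the same side a gap. In each square the two gaps add up to at most 10. They are even
  because of a common neighbour, and they are not 2, because leaves at distance 2 are equally far
  from everything else, whereas a neighbouring square contains a leaf at distance 5 from only one of
  the two. So each square has a gap 4. By \<open>domino_short_gap\<close> a gap 4 in one square spreads to the
  same side of a neighbouring square and makes the opposite gap there 6. In \<open>L\<^sub>3\<close> a
  gap 4 in the middle square, say on the side of \<open>x\<close>, spreads in both directions, and then the four-point condition forces
  \<open>d x\<^sub>0 y\<^sub>3 = 5\<close> although \<open>x\<^sub>0 y\<^sub>3\<close> is not an edge (\<open>no_ladder_3\<close>). Every
  longer ladder has \<open>L\<^sub>3\<close> as an induced subgraph.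

  For \<open>t \<le> 2\<close> explicit trees work.

  Both directions rest on one description of trees: the trees are exactly the graphs that arise from
  a single vertex by attaching leaves one at a time (\<open>undirected_tree_attach_tree\<close>,
  \<open>undirected_tree_eq_attach_tree\<close>). Along such a construction the distance obeys a recursion,
  \<open>attach_dist\<close>. Induction over it gives the four-point and the parity condition for arbitrary
  trees, and rewriting with it evaluates the distances in a concrete tree.
\<close>

section \<open>Cycles, connectedness and distance in terms of the arc relation\<close>

definition closed_vertex_cycle :: "('a \<times> 'a) set \<Rightarrow> 'a list \<Rightarrow> bool" where
  "closed_vertex_cycle E vs \<longleftrightarrow> length vs \<ge> 3 \<and> distinct vs \<and>
     successively (\<lambda>u v. (u, v) \<in> E) vs \<and> (last vs, hd vs) \<in> E"

text \<open>
  A walk given by its arcs is determined by the tails of the arcs. This translates the cycles of the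
  library, which are lists of arcs, into cyclic lists of vertices.
\<close>

lemma pcas_fst_walk:
  assumes "pcas u p v" "set p \<subseteq> E" "p \<noteq> []"
  shows "hd (map fst p) = u \<and> successively (\<lambda>a b. (a, b) \<in> E) (map fst p) \<and>
         (last (map fst p), v) \<in> E \<and> pawalk_verts u p = map fst p @ [v]"
  using assms
proof (induction p arbitrary: u)
  case (Cons e p)
  obtain a b where e: "e = (a, b)" by (cases e)
  show ?case
  proof (cases p)
    case Nil
    then show ?thesis using Cons.prems by (auto simp: e)
  next
    case (Cons f q)
    then show ?thesis using Cons.IH[of b] Cons.prems by (auto simp: e)
  qed
qed simp

lemma walk_of_vertices:
  assumes "successively (\<lambda>a b. (a, b) \<in> E) (u # vs @ [w])"
  shows "\<exists>p. pcas u p w \<and> set p \<subseteq> E \<and> map fst p = u # vs"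
  using assms
proof (induction vs arbitrary: u)
  case Nil
  then show ?case by (intro exI[of _ "[(u, w)]"]) auto
next
  case (Cons v vs)
  have "\<exists>p. pcas v p w \<and> set p \<subseteq> E \<and> map fst p = v # vs"
    by (rule Cons.IH) (use Cons.prems in simp)
  then obtain p where "pcas v p w" "set p \<subseteq> E" "map fst p = v # vs" by (elim exE conjE)
  then show ?case using Cons.prems by (intro exI[of _ "(u, v) # p"]) auto
qed

lemma cycle_iff_closed_vertex_cycle:
  assumes "pair_graph T"
  shows "(\<exists>p. pre_digraph.cycle (with_proj T) p \<and> length p \<ge> 3) \<longleftrightarrow>
         (\<exists>vs. closed_vertex_cycle (parcs T) vs)"
proof -
  interpret pair_graph T by fact
  show ?thesis
  proof
    assume "\<exists>p. cycle p \<and> length p \<ge> 3"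
    then obtain p u where p: "awalk u p u" "distinct (tl (awalk_verts u p))" "length p \<ge> 3"
      by (auto simp: cycle_def)
    have c: "pcas u p u" "set p \<subseteq> parcs T" "p \<noteq> []"
      using p by (auto simp: awalk_def)
    note w = pcas_fst_walk[OF c]
    obtain v vs where vs: "map fst p = v # vs" using c(3) by (cases p) auto
    have "distinct (map fst p)" using w p(2) by (auto simp: vs)
    then have "closed_vertex_cycle (parcs T) (map fst p)"
      unfolding closed_vertex_cycle_def using w p(3) by simp
    then show "\<exists>vs. closed_vertex_cycle (parcs T) vs" ..
  next
    assume "\<exists>vs. closed_vertex_cycle (parcs T) vs"
    then obtain vs where cyc: "closed_vertex_cycle (parcs T) vs" ..
    then obtain u us where vs: "vs = u # us" by (cases vs) (auto simp: closed_vertex_cycle_def)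
    have "successively (\<lambda>a b. (a, b) \<in> parcs T) (u # us @ [u])"
      using cyc unfolding closed_vertex_cycle_def vs
      by (metis append_Cons hd_conv_nth hd_append2 list.distinct(1) list.sel(1) successively.simps(2)
          successively_append_iff)
    from walk_of_vertices[OF this] obtain p
      where p: "pcas u p u" "set p \<subseteq> parcs T" "map fst p = u # us"
      by (elim exE conjE)
    then have ne: "p \<noteq> []" by auto
    have "u \<in> pverts T" using p ne by (cases p) (auto dest: in_arcsD1)
    moreover have "distinct (tl (pawalk_verts u p))"
      using pcas_fst_walk[OF p(1,2) ne] cyc by (auto simp: p(3) closed_vertex_cycle_def vs)
    moreover have "length p \<ge> 3"
      using cyc p(3) by (metis closed_vertex_cycle_def length_map vs)
    ultimately have "cycle p \<and> length p \<ge> 3"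
      using p ne unfolding cycle_def awalk_def by auto
    then show "\<exists>p. cycle p \<and> length p \<ge> 3" ..
  qed
qed

lemma connected_iff_rtrancl:
  assumes "pair_graph T"
  shows "connected (with_proj T) \<longleftrightarrow>
    pverts T \<noteq> {} \<and> (\<forall>u \<in> pverts T. \<forall>v \<in> pverts T. (u, v) \<in> (parcs T)\<^sup>*)"
proof -
  interpret pair_graph T by fact
  have sym: "(parcs T)\<^sup>s = parcs T"
    using pair_sym_arcs by (auto simp: symcl_def symmetric_def sym_def)
  have "(u, v) \<in> rtrancl_on (pverts T) (parcs T) \<longleftrightarrow> (u, v) \<in> (parcs T)\<^sup>*"
    if "u \<in> pverts T" for u v
  proof
    assume "(u, v) \<in> rtrancl_on (pverts T) (parcs T)"
    then show "(u, v) \<in> (parcs T)\<^sup>*" by induction auto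
  next
    assume "(u, v) \<in> (parcs T)\<^sup>*"
    then show "(u, v) \<in> rtrancl_on (pverts T) (parcs T)"
      using that
    proof induction
      case (step y z)
      then show ?case by (meson in_arcsD2 in_arcsD1 rtrancl_on_into_rtrancl_on)
    qed simp
  qed
  then show ?thesis unfolding connected_conv by (auto simp: sym)
qed

lemma pcas_imp_relpow:
  "pcas u p v \<Longrightarrow> set p \<subseteq> E \<Longrightarrow> (u, v) \<in> E ^^ length p"
  by (induction p arbitrary: u) (auto simp del: relpow.simps(2) intro: relpow_Suc_I2)

lemma relpow_imp_pcas:
  "(u, v) \<in> E ^^ n \<Longrightarrow> \<exists>p. pcas u p v \<and> set p \<subseteq> E \<and> length p = n"
proof (induction n arbitrary: u)
  case (Suc n)
  then obtain w where w: "(u, w) \<in> E" "(w, v) \<in> E ^^ n" by (meson relpow_Suc_E2)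
  then obtain p where "pcas w p v \<and> set p \<subseteq> E \<and> length p = n" using Suc.IH by blast
  then show ?case using w by (intro exI[of _ "(u, w) # p"]) auto
qed simp

lemma graph_dist_eqI:
  assumes "pair_graph T" "u \<in> pverts T" "(u, v) \<in> parcs T ^^ n"
    and "\<And>m. (u, v) \<in> parcs T ^^ m \<Longrightarrow> n \<le> m"
  shows "graph_dist T u v = ereal (real n)"
proof -
  interpret pair_graph T by fact
  have len: "awalk_cost (\<lambda>_. 1) p = real (length p)" for p :: "('a \<times> 'a) list"
    by (induction p) auto
  obtain p where p: "pcas u p v" "set p \<subseteq> parcs T" "length p = n"
    using relpow_imp_pcas[OF assms(3)] by blast
  have "\<mu> (\<lambda>_. 1) u v = ereal (real n)"
    unfolding \<mu>_def
  proof (rule antisym)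
    show "(INF p\<in>{p. awalk u p v}. ereal (awalk_cost (\<lambda>_. 1) p)) \<le> ereal (real n)"
      using p assms(2) by (intro INF_lower2[of p]) (auto simp: awalk_def len)
    show "ereal (real n) \<le> (INF p\<in>{p. awalk u p v}. ereal (awalk_cost (\<lambda>_. 1) p))"
      using assms(4) pcas_imp_relpow[of u _ v "parcs T"]
      by (intro INF_greatest) (auto simp: awalk_def len)
  qed
  then show ?thesis by (simp add: graph_dist_def)
qed

section \<open>Trees built by attaching leaves\<close>

text \<open>
  The list holds pairs of a new leaf and the vertex to which it is attached. It is read from its end:
  the head is the leaf attached last.
\<close>

definition attach_tree :: "'a \<Rightarrow> ('a \<times> 'a) list \<Rightarrow> 'a pair_pre_digraph" where
  "attach_tree r es = \<lparr>pverts = insert r (fst ` set es), parcs = set es \<union> (set es)\<inverse>\<rparr>"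

primrec attachable :: "'a \<Rightarrow> ('a \<times> 'a) list \<Rightarrow> bool" where
  "attachable r [] \<longleftrightarrow> True"
| "attachable r (e # es) \<longleftrightarrow> fst e \<notin> insert r (fst ` set es) \<and>
     snd e \<in> insert r (fst ` set es) \<and> attachable r es"

text \<open>
  A path that ends in the leaf attached last uses the only edge there, and the other distances do not
  change.
\<close>

primrec attach_dist :: "('a \<times> 'a) list \<Rightarrow> 'a \<Rightarrow> 'a \<Rightarrow> nat" where
  "attach_dist [] u v = 0"
| "attach_dist (e # es) u v =
     (if u = v then 0
      else if u = fst e then Suc (attach_dist es (snd e) v)
      else if v = fst e then Suc (attach_dist es u (snd e))
      else attach_dist es u v)"

lemma attach_dist_refl [simp]: "attach_dist es u u = 0"
  by (cases es) auto

lemma attach_dist_sym: "attach_dist es u v = attach_dist es v u"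
  by (induction es arbitrary: u v) auto

lemma attach_dist_triangle: "attach_dist es u v \<le> attach_dist es u w + attach_dist es w v"
proof (induction es arbitrary: u v w)
  case (Cons e es)
  obtain l p where e: "e = (l, p)" by (cases e)
  show ?case
    using Cons.IH[of u v w] Cons.IH[of p v w] Cons.IH[of u p w] Cons.IH[of u v p]
    by (auto simp: e)
qed simp

text \<open>
  If exactly one of the four points is the leaf attached last, replacing it by the vertex that
  carries it lowers all three sums by one. If two of the points coincide, the claim is the triangle
  inequality.
\<close>

lemma attach_dist_four_point:
  "attach_dist es u v + attach_dist es w z \<le>
     max (attach_dist es u w + attach_dist es v z) (attach_dist es u z + attach_dist es v w)"
proof (induction es arbitrary: u v w z)
  case (Cons e es)
  obtain l p where e: "e = (l, p)" by (cases e)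
  let ?d = "attach_dist (e # es)"
  show ?case
  proof (cases "distinct [u, v, w, z]")
    case True
    then consider "l = u" | "l = v" | "l = w" | "l = z" | "l \<notin> {u, v, w, z}" by blast
    then show ?thesis
    proof cases
      case 1
      then show ?thesis using True Cons.IH[of p v w z] by (auto simp: e)
    next
      case 2
      then show ?thesis using True Cons.IH[of u p w z] by (auto simp: e)
    next
      case 3
      then show ?thesis using True Cons.IH[of u v p z] by (auto simp: e)
    next
      case 4
      then show ?thesis using True Cons.IH[of u v w p] by (auto simp: e)
    next
      case 5
      then show ?thesis using True Cons.IH[of u v w z] by (auto simp: e)
    qed
  next
    case False
    then have "u = v \<or> u = w \<or> u = z \<or> v = w \<or> v = z \<or> w = z" by auto
    moreover note attach_dist_triangle[of "e # es" w z u] attach_dist_triangle[of "e # es" u v w]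
      attach_dist_sym[of "e # es" v u] attach_dist_sym[of "e # es" w u]
      attach_dist_sym[of "e # es" w v] attach_dist_sym[of "e # es" z v]
    ultimately show ?thesis
      by (elim disjE) (simp_all del: attach_dist.simps)
  qed
qed simp

text \<open>
  Each of the three points occurs in two of the three summands, so a step from the leaf attached last
  to the vertex that carries it changes the sum by an even number.
\<close>

lemma attach_dist_parity:
  "even (attach_dist es u v + attach_dist es v w + attach_dist es u w)"
proof (induction es arbitrary: u v w)
  case (Cons e es)
  obtain l p where e: "e = (l, p)" by (cases e)
  show ?case
    using Cons.IH[of u v w] Cons.IH[of p v w] Cons.IH[of u p w] Cons.IH[of u v p]
      attach_dist_sym[of es p u] attach_dist_sym[of es p v] attach_dist_sym[of es p w]
      attach_dist_sym[of es u v] attach_dist_sym[of es v w] attach_dist_sym[of es u w]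
    by (auto simp: e)
qed simp

lemma attach_dist_walk:
  assumes "attachable r es" "u \<in> pverts (attach_tree r es)" "v \<in> pverts (attach_tree r es)"
  shows "(u, v) \<in> parcs (attach_tree r es) ^^ attach_dist es u v"
  using assms
proof (induction es arbitrary: u v)
  case (Cons e es)
  obtain l p where e: "e = (l, p)" by (cases e)
  let ?V = "pverts (attach_tree r es)" and ?E = "parcs (attach_tree r es)"
    and ?E' = "parcs (attach_tree r (e # es))"
  have p: "p \<in> ?V" and IH: "a \<in> ?V \<Longrightarrow> b \<in> ?V \<Longrightarrow> (a, b) \<in> ?E ^^ attach_dist es a b" for a b
    using Cons by (auto simp: e attach_tree_def)
  have "?E \<subseteq> ?E'" by (auto simp: attach_tree_def)
  then have "?E ^^ n \<subseteq> ?E' ^^ n" for n by (induction n) auto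
  then have IH': "a \<in> ?V \<Longrightarrow> b \<in> ?V \<Longrightarrow> (a, b) \<in> ?E' ^^ attach_dist es a b" for a b
    using IH by blast
  have lp: "(l, p) \<in> ?E'" "(p, l) \<in> ?E'" by (auto simp: attach_tree_def e)
  have mem: "a \<in> ?V" if "a \<in> pverts (attach_tree r (e # es))" "a \<noteq> l" for a
    using that by (auto simp: attach_tree_def e)
  consider "u = v" | "u \<noteq> v" "u = l" | "u \<noteq> v" "v = l" | "u \<noteq> v" "u \<noteq> l" "v \<noteq> l" by blast
  then show ?case
  proof cases
    case 2
    then have "(l, v) \<in> ?E' ^^ Suc (attach_dist es p v)"
      using lp p IH' mem Cons.prems(3) by (blast intro: relpow_Suc_I2)
    then show ?thesis using 2 by (simp add: e)
  next
    case 3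
    then have "(u, l) \<in> ?E' ^^ Suc (attach_dist es u p)"
      using lp p IH' mem Cons.prems(2) by (blast intro: relpow_Suc_I)
    then show ?thesis using 3 by (simp add: e)
  qed (use IH' mem Cons.prems in \<open>auto simp: e\<close>)
qed (auto simp: attach_tree_def)

lemma attachable_arc_vertices:
  "attachable r es \<Longrightarrow> (a, b) \<in> set es \<Longrightarrow>
     a \<noteq> b \<and> a \<in> insert r (fst ` set es) \<and> b \<in> insert r (fst ` set es)"
  by (induction es) (auto, (force intro: rev_image_eqI)+)

lemma attach_dist_arc:
  assumes "attachable r es" "(u, v) \<in> parcs (attach_tree r es)"
  shows "attach_dist es u v = 1"
  using assms
proof (induction es)
  case (Cons e es)
  obtain l p where e: "e = (l, p)" by (cases e)
  show ?case using Cons attachable_arc_vertices[of r es u v] attachable_arc_vertices[of r es v u]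
    by (auto simp: e attach_tree_def)
qed (auto simp: attach_tree_def)

text \<open>
  No walk is shorter than \<^const>\<open>attach_dist\<close>, because by the triangle inequality the distance
  from \<open>u\<close> grows by at most one along an arc.
\<close>

lemma attach_dist_le_walk:
  assumes "attachable r es" "(u, v) \<in> parcs (attach_tree r es) ^^ n"
  shows "attach_dist es u v \<le> n"
  using assms(2)
proof (induction n arbitrary: v)
  case (Suc n)
  then obtain w where w: "(u, w) \<in> parcs (attach_tree r es) ^^ n" "(w, v) \<in> parcs (attach_tree r es)"
    by auto
  then show ?case
    using Suc.IH[OF w(1)] attach_dist_arc[OF assms(1) w(2)] attach_dist_triangle[of es u v w]
    by simp
qed simp

lemma pair_graph_attach_tree:
  assumes "attachable r es"
  shows "pair_graph (attach_tree r es)"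
proof -
  note v = attachable_arc_vertices[OF assms]
  show ?thesis
    by unfold_locales
      (use v in \<open>fastforce simp: attach_tree_def symmetric_def sym_def\<close>)+
qed

lemma graph_dist_attach_tree:
  assumes "attachable r es" "u \<in> pverts (attach_tree r es)" "v \<in> pverts (attach_tree r es)"
  shows "graph_dist (attach_tree r es) u v = ereal (real (attach_dist es u v))"
  by (rule graph_dist_eqI)
    (use assms in \<open>auto simp: pair_graph_attach_tree attach_dist_walk attach_dist_le_walk\<close>)

lemma closed_vertex_cycle_rotate:
  assumes "closed_vertex_cycle E (xs @ ys)"
  shows "closed_vertex_cycle E (ys @ xs)"
proof (cases "xs = [] \<or> ys = []")
  case True
  then show ?thesis using assms by auto
next
  case False
  then show ?thesis using assms
    by (auto simp: closed_vertex_cycle_def successively_append_iff)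
qed

text \<open>
  A vertex of degree 1 lies on no cycle, since a cycle of length at least 3 enters and leaves each
  of its vertices through different neighbours. Hence attaching a leaf creates no cycle.
\<close>

lemma closed_vertex_cycle_two_neighbours:
  assumes "closed_vertex_cycle E vs" "v \<in> set vs"
  shows "\<exists>a b. a \<noteq> b \<and> (v, a) \<in> E \<and> (b, v) \<in> E"
proof -
  obtain xs ys where "vs = xs @ v # ys" using assms(2) by (meson split_list)
  then have cyc: "closed_vertex_cycle E (v # ys @ xs)"
    using closed_vertex_cycle_rotate[of E xs "v # ys"] assms(1) by simp
  then obtain a zs where zs: "ys @ xs = a # zs" "zs \<noteq> []"
    by (cases "ys @ xs"; cases "tl (ys @ xs)") (auto simp: closed_vertex_cycle_def)
  then have "a \<noteq> last zs" "(v, a) \<in> E" "(last zs, v) \<in> E"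
    using cyc by (auto simp: closed_vertex_cycle_def)
  then show ?thesis by blast
qed

lemma no_closed_vertex_cycle_attach_tree:
  assumes "attachable r es"
  shows "\<not> closed_vertex_cycle (parcs (attach_tree r es)) vs"
  using assms
proof (induction es)
  case Nil
  show ?case
    using closed_vertex_cycle_two_neighbours[of "{}" vs "hd vs"]
    by (cases vs) (auto simp: attach_tree_def closed_vertex_cycle_def)
next
  case (Cons e es)
  obtain l p where e: "e = (l, p)" by (cases e)
  let ?E = "parcs (attach_tree r es)" and ?E' = "parcs (attach_tree r (e # es))"
  show ?case
  proof
    assume cyc: "closed_vertex_cycle ?E' vs"
    have only: "a = p" if "(l, a) \<in> ?E' \<or> (a, l) \<in> ?E'" for a
      using that Cons.prems attachable_arc_vertices[of r es] by (fastforce simp: e attach_tree_def)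
    have "l \<notin> set vs"
      using closed_vertex_cycle_two_neighbours[OF cyc] only by blast
    then have "successively (\<lambda>a b. (a, b) \<in> ?E) vs"
      using cyc unfolding closed_vertex_cycle_def
      by (elim conjE, elim successively_mono) (auto simp: e attach_tree_def)
    moreover have "(last vs, hd vs) \<in> ?E"
    proof -
      have "vs \<noteq> []" using cyc by (auto simp: closed_vertex_cycle_def)
      then have "last vs \<noteq> l" "hd vs \<noteq> l" using \<open>l \<notin> set vs\<close> by auto
      then show ?thesis using cyc by (auto simp: closed_vertex_cycle_def e attach_tree_def)
    qed
    ultimately have "closed_vertex_cycle ?E vs" using cyc by (simp add: closed_vertex_cycle_def)
    then show False using Cons by simp
  qed
qed

lemma undirected_tree_iff:
  "undirected_tree T \<longleftrightarrow> pair_graph T \<and> pverts T \<noteq> {} \<and>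
     (\<forall>u \<in> pverts T. \<forall>v \<in> pverts T. (u, v) \<in> (parcs T)\<^sup>*) \<and>
     (\<forall>vs. \<not> closed_vertex_cycle (parcs T) vs)"
proof (cases "pair_graph T")
  case True
  show ?thesis
    unfolding undirected_tree_def cycle_iff_closed_vertex_cycle[OF True]
      connected_iff_rtrancl[OF True] by auto
qed (simp add: undirected_tree_def)

lemma undirected_tree_attach_tree:
  assumes "attachable r es"
  shows "undirected_tree (attach_tree r es)"
  unfolding undirected_tree_iff
proof (intro conjI ballI allI)
  show "pair_graph (attach_tree r es)" by (rule pair_graph_attach_tree[OF assms])
  show "pverts (attach_tree r es) \<noteq> {}" by (simp add: attach_tree_def)
  show "(u, v) \<in> (parcs (attach_tree r es))\<^sup>*"
    if "u \<in> pverts (attach_tree r es)" "v \<in> pverts (attach_tree r es)" for u v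
    using attach_dist_walk[OF assms that] by (rule relpow_imp_rtrancl)
  show "\<not> closed_vertex_cycle (parcs (attach_tree r es)) vs" for vs
    by (rule no_closed_vertex_cycle_attach_tree[OF assms])
qed

section \<open>Every tree is built by attaching leaves\<close>

text \<open>
  The first vertex \<open>l\<close> of a longest path is a leaf: a neighbour outside the path would extend it,
  and a neighbour further along the path than the second vertex would close a cycle.
\<close>

lemma undirected_tree_has_leaf:
  assumes T: "undirected_tree T" and nontriv: "pverts T \<noteq> {r}" "r \<in> pverts T"
  obtains l p where "(l, p) \<in> parcs T" "\<And>w. (l, w) \<in> parcs T \<Longrightarrow> w = p"
proof -
  from T have pg: "pair_graph T" by (simp add: undirected_tree_iff)
  interpret pair_graph T by fact
  define path where "path vs \<longleftrightarrow> vs \<noteq> [] \<and> distinct vs \<and> set vs \<subseteq> pverts T \<and>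
      successively (\<lambda>a b. (a, b) \<in> parcs T) vs" for vs
  have "path [r]" using nontriv by (simp add: path_def)
  moreover have "length vs \<le> card (pverts T)" if "path vs" for vs
    using that pair_finite_verts by (metis card_mono distinct_card path_def)
  then have "\<forall>vs. path vs \<longrightarrow> length vs < Suc (card (pverts T))" by (simp add: less_Suc_eq_le)
  ultimately obtain vs where vs: "path vs" "\<And>us. path us \<Longrightarrow> length us \<le> length vs"
    using ex_has_greatest_nat[of path "[r]" length "Suc (card (pverts T))"] by blast
  then obtain l ws where l: "vs = l # ws" by (cases vs) (auto simp: path_def)
  have "l \<in> pverts T" using vs(1) by (simp add: path_def l)
  obtain z where "z \<in> pverts T" "z \<noteq> l" using nontriv by blast
  then have "(l, z) \<in> (parcs T)\<^sup>*" using T \<open>l \<in> pverts T\<close> by (simp add: undirected_tree_iff)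
  then obtain p where p: "(l, p) \<in> parcs T" using \<open>z \<noteq> l\<close>
    by (cases rule: converse_rtranclE) auto
  have "w = hd ws" if w: "(l, w) \<in> parcs T" for w
  proof -
    have wl: "w \<noteq> l" "(w, l) \<in> parcs T" "w \<in> pverts T"
      using w no_loops' arcs_symmetric in_arcsD2 by blast+
    have "\<not> path (w # vs)" using vs(2)[of "w # vs"] by auto
    then have "w \<in> set vs" using vs(1) wl by (auto simp: path_def l)
    then obtain us ys where ws: "ws = us @ w # ys" using wl(1) by (auto simp: l dest: split_list)
    show ?thesis
    proof (cases us)
      case Nil
      then show ?thesis by (simp add: ws)
    next
      case (Cons a as)
      have "successively (\<lambda>a b. (a, b) \<in> parcs T) ((l # us @ [w]) @ ys)"
        using vs(1) by (simp add: path_def l ws)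
      then have "successively (\<lambda>a b. (a, b) \<in> parcs T) (l # us @ [w])"
        by (meson successively_append_iff)
      then have "closed_vertex_cycle (parcs T) (l # us @ [w])"
        using vs(1) wl by (auto simp: closed_vertex_cycle_def path_def l ws Cons)
      then show ?thesis using T by (simp add: undirected_tree_iff)
    qed
  qed
  then show thesis using that p by metis
qed

definition delete_vertex :: "'a pair_pre_digraph \<Rightarrow> 'a \<Rightarrow> 'a pair_pre_digraph" where
  "delete_vertex T l = \<lparr>pverts = pverts T - {l}, parcs = {(a, b) \<in> parcs T. a \<noteq> l \<and> b \<noteq> l}\<rparr>"

text \<open>
  Connectedness survives because replacing each visit to the leaf \<open>l\<close> by a stay in its neighbour
  \<open>p\<close> turns a walk between other vertices into one that avoids \<open>l\<close>.
\<close>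

lemma undirected_tree_delete_leaf:
  assumes T: "undirected_tree T" and l: "(l, p) \<in> parcs T" "\<And>w. (l, w) \<in> parcs T \<Longrightarrow> w = p"
  shows "undirected_tree (delete_vertex T l)"
  unfolding undirected_tree_iff
proof (intro conjI ballI allI)
  from T have pg: "pair_graph T" by (simp add: undirected_tree_iff)
  interpret pair_graph T by fact
  let ?T = "delete_vertex T l"
  have sub: "parcs ?T \<subseteq> parcs T" by (auto simp: delete_vertex_def)
  show "pair_graph ?T"
  proof
    show "finite (pverts ?T)" using pair_finite_verts by (simp add: delete_vertex_def)
    show "finite (parcs ?T)" using pair_finite_arcs sub by (rule rev_finite_subset)
    show "symmetric (with_proj ?T)"
      using arcs_symmetric by (auto simp: symmetric_def sym_def delete_vertex_def)
  qed (auto simp: delete_vertex_def no_loops' dest: in_arcsD1 in_arcsD2)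
  have pl: "p \<noteq> l" "p \<in> pverts T" using l(1) no_loops' in_arcsD2 by blast+
  then show "pverts ?T \<noteq> {}" by (auto simp: delete_vertex_def)
  show "\<not> closed_vertex_cycle (parcs ?T) vs" for vs
  proof
    assume "closed_vertex_cycle (parcs ?T) vs"
    then have "closed_vertex_cycle (parcs T) vs"
      using sub unfolding closed_vertex_cycle_def by (auto elim: successively_mono)
    then show False using T by (simp add: undirected_tree_iff)
  qed
  show "(u, v) \<in> (parcs ?T)\<^sup>*" if "u \<in> pverts ?T" "v \<in> pverts ?T" for u v
  proof -
    have uv: "u \<in> pverts T" "v \<in> pverts T" "u \<noteq> l" "v \<noteq> l"
      using that by (auto simp: delete_vertex_def)
    then have "(u, v) \<in> (parcs T)\<^sup>*" using T by (simp add: undirected_tree_iff)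
    then have "(u, if v = l then p else v) \<in> (parcs ?T)\<^sup>*"
    proof induction
      case base
      then show ?case using uv by simp
    next
      case (step y z)
      show ?case
      proof (cases "y = l \<or> z = l")
        case True
        then have "(if z = l then p else z) = (if y = l then p else y)"
          using step.hyps(2) l(2) arcs_symmetric no_loops' by metis
        then show ?thesis using step.IH by simp
      next
        case False
        then have "(y, z) \<in> parcs ?T" using step.hyps(2) by (simp add: delete_vertex_def)
        then show ?thesis using step.IH False by (auto intro: rtrancl_into_rtrancl)
      qed
    qed
    then show ?thesis using uv by simp
  qed
qed

lemma undirected_tree_eq_attach_tree:
  assumes "undirected_tree T"
  shows "\<exists>r es. attachable r es \<and> T = attach_tree r es"
  using assms
proof (induction "card (pverts T)" arbitrary: T rule: less_induct)
  case less
  from less.prems have pg: "pair_graph T" by (simp add: undirected_tree_iff)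
  interpret pair_graph T by fact
  obtain r where r: "r \<in> pverts T" using less.prems by (auto simp: undirected_tree_iff)
  show ?case
  proof (cases "pverts T = {r}")
    case True
    have "parcs T = {}"
    proof (rule equals0I)
      fix e assume "e \<in> parcs T"
      then show False using True no_loops' in_arcsD1 in_arcsD2 by (cases e) fastforce
    qed
    then have "T = attach_tree r []" using True by (simp add: attach_tree_def)
    then show ?thesis by (intro exI[of _ r] exI[of _ "[]"]) simp
  next
    case False
    obtain l p where l: "(l, p) \<in> parcs T" "\<And>w. (l, w) \<in> parcs T \<Longrightarrow> w = p"
      using undirected_tree_has_leaf[OF less.prems False r] by metis
    let ?T = "delete_vertex T l"
    have lp: "l \<in> pverts T" "p \<in> pverts T" "p \<noteq> l"
      using l(1) no_loops' in_arcsD1 in_arcsD2 by blast+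
    have "card (pverts ?T) < card (pverts T)"
      using lp(1) pair_finite_verts by (simp add: delete_vertex_def card_Diff1_less del: card_Diff_insert)
    then obtain s es where es: "attachable s es" "?T = attach_tree s es"
      using less.hyps undirected_tree_delete_leaf[OF less.prems l] by blast
    have V: "pverts T - {l} = insert s (fst ` set es)"
      using arg_cong[OF es(2), of pverts] by (simp add: delete_vertex_def attach_tree_def)
    have E: "{(a, b) \<in> parcs T. a \<noteq> l \<and> b \<noteq> l} = set es \<union> (set es)\<inverse>"
      using arg_cong[OF es(2), of parcs] by (simp add: delete_vertex_def attach_tree_def)
    have "attachable s ((l, p) # es)" using es(1) V lp by auto
    moreover have "pverts T = insert s (fst ` set ((l, p) # es))"
      using V lp(1) by auto
    moreover have "parcs T = set ((l, p) # es) \<union> (set ((l, p) # es))\<inverse>"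
    proof -
      have "parcs T = {(a, b) \<in> parcs T. a \<noteq> l \<and> b \<noteq> l} \<union> {(l, p), (p, l)}"
      proof -
        have "a = p" if "(a, l) \<in> parcs T" for a
          using arcs_symmetric[OF that] by (rule l(2))
        moreover have "(p, l) \<in> parcs T" using arcs_symmetric[OF l(1)] .
        ultimately show ?thesis using l by blast
      qed
      also have "\<dots> = set ((l, p) # es) \<union> (set ((l, p) # es))\<inverse>"
        unfolding E by auto
      finally show ?thesis .
    qed
    ultimately show ?thesis
      by (intro exI[of _ s] exI[of _ "(l, p) # es"]) (simp add: attach_tree_def)
  qed
qed

section \<open>Distances between the leaves of a tree\<close>

lemma leaf_unique_arc:
  assumes "undirected_tree T" "v \<in> leaves T"
  obtains p where "p \<in> pverts T" "\<And>w. (v, w) \<in> parcs T \<Longrightarrow> w = p"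
proof -
  interpret pair_graph T using assms(1) by (simp add: undirected_tree_iff)
  have "card (out_arcs (with_proj T) v) = 1"
    using assms(2) by (simp add: leaves_def out_degree_def)
  then obtain e where e: "out_arcs (with_proj T) v = {e}" by (auto simp: card_1_singleton_iff)
  have "e \<in> out_arcs (with_proj T) v" by (simp add: e)
  then have "snd e \<in> pverts T" by (cases e) (auto dest: in_arcsD2)
  moreover have "w = snd e" if "(v, w) \<in> parcs T" for w
  proof -
    have "(v, w) \<in> out_arcs (with_proj T) v" using that by simp
    then show ?thesis by (auto simp: e)
  qed
  ultimately show thesis by (rule that)
qed

text \<open>
  The condition on leaves says that the paths from \<open>v\<close> to \<open>u\<close> and to
  \<open>w\<close> share at least their first edge.
\<close>

locale leaf_metric =
  fixes L :: "'a set" and d :: "'a \<Rightarrow> 'a \<Rightarrow> nat"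
  assumes d_sym: "d u v = d v u"
    and d_refl [simp]: "d u u = 0"
    and four_point: "d u v + d w z \<le> max (d u w + d v z) (d u z + d v w)"
    and parity: "even (d u v + d v w + d u w)"
    and leaf: "v \<in> L \<Longrightarrow> u \<in> L \<Longrightarrow> w \<in> L \<Longrightarrow> u \<noteq> v \<Longrightarrow> w \<noteq> v \<Longrightarrow>
      d u w + 2 \<le> d v u + d v w"

lemma undirected_tree_leaf_metric:
  assumes T: "undirected_tree T"
  obtains d where "leaf_metric (leaves T) d"
    "\<And>u v. u \<in> pverts T \<Longrightarrow> v \<in> pverts T \<Longrightarrow> graph_dist T u v = ereal (real (d u v))"
proof -
  obtain r es where es: "attachable r es" "T = attach_tree r es"
    using undirected_tree_eq_attach_tree[OF T] by blast
  let ?d = "attach_dist es"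
  have sub: "leaves T \<subseteq> pverts T" by (auto simp: leaves_def)
  have "leaf_metric (leaves T) ?d"
  proof
    fix v u w assume v: "v \<in> leaves T" and uw: "u \<in> leaves T" "w \<in> leaves T" "u \<noteq> v" "w \<noteq> v"
    obtain p where p: "p \<in> pverts T" "\<And>w. (v, w) \<in> parcs T \<Longrightarrow> w = p"
      using leaf_unique_arc[OF T v] by metis
    have step: "?d p x + 1 \<le> ?d v x" if "x \<in> leaves T" "x \<noteq> v" for x
    proof -
      have walk: "(v, x) \<in> parcs T ^^ ?d v x"
        using attach_dist_walk[OF es(1), of v x] es(2) sub v that by auto
      then obtain n where n: "?d v x = Suc n" using walk \<open>x \<noteq> v\<close> by (cases "?d v x") auto
      then have "(p, x) \<in> parcs T ^^ n" using walk p(2) by (metis relpow_Suc_E2)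
      then show ?thesis using attach_dist_le_walk[OF es(1)] es(2) n by fastforce
    qed
    show "?d u w + 2 \<le> ?d v u + ?d v w"
      using step[of u] step[of w] uw attach_dist_triangle[of es u w p] attach_dist_sym[of es u p]
      by simp
  qed (rule attach_dist_sym attach_dist_refl attach_dist_four_point attach_dist_parity)+
  then show thesis using that graph_dist_attach_tree[OF es(1)] es(2) by metis
qed

section \<open>Why the ladder with eight vertices is impossible\<close>

context leaf_metric begin

text \<open>
  These distances describe an induced \<open>L\<^sub>2\<close> with sides \<open>a\<close> and \<open>b\<close>: two vertices of the same
  side have an even distance, by parity.
\<close>

definition domino :: "'a \<Rightarrow> 'a \<Rightarrow> 'a \<Rightarrow> 'a \<Rightarrow> 'a \<Rightarrow> 'a \<Rightarrow> bool" where
  "domino a0 a1 a2 b0 b1 b2 \<longleftrightarrow>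
     {a0, a1, a2, b0, b1, b2} \<subseteq> L \<and> distinct [a0, a1, a2, b0, b1, b2] \<and>
     d a0 b0 = 5 \<and> d a0 b1 = 5 \<and> d a1 b0 = 5 \<and> d a1 b1 = 5 \<and> d a1 b2 = 5 \<and>
     d a2 b1 = 5 \<and> d a2 b2 = 5 \<and> d a0 b2 \<noteq> 5 \<and> d a2 b0 \<noteq> 5"

lemma domino_rev: "domino a0 a1 a2 b0 b1 b2 \<Longrightarrow> domino a2 a1 a0 b2 b1 b0"
  by (auto simp: domino_def)

lemma domino_swap: "domino a0 a1 a2 b0 b1 b2 \<Longrightarrow> domino b0 b1 b2 a0 a1 a2"
  using d_sym by (fastforce simp: domino_def)

text \<open>
  The gap between \<open>u\<close> and \<open>v\<close> is even because of the common neighbour \<open>s\<close>. It is not 2,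
  because then the leaf condition at \<open>u\<close> and at \<open>v\<close> would give \<open>d u w = d v w\<close>. A value 0 is
  excluded by the same two inequalities.
\<close>

lemma gap_ge_4:
  assumes "u \<in> L" "v \<in> L" "w \<in> L" "distinct [u, v, w]" "d u s = 5" "d v s = 5"
    and "d u w \<noteq> d v w"
  shows "d u v = 4 \<or> d u v \<ge> 6"
proof -
  have "even (d u v)" using parity[of u s v] assms(5,6) d_sym[of s v] by simp
  moreover have "d u v > 2"
    using leaf[of u v w] leaf[of v u w] assms d_sym[of u v] by auto
  ultimately show ?thesis by presburger
qed

lemma square_gaps:
  assumes "d a0 b0 = 5" "d a0 b1 = 5" "d a1 b0 = 5" "d a1 b1 = 5"
  shows "d a0 a1 + d b0 b1 \<le> 10"
  using four_point[of a0 a1 b0 b1] assms by simp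

lemma domino_gaps:
  assumes "domino a0 a1 a2 b0 b1 b2"
  shows "d a0 a1 \<in> {4, 6}" "d b0 b1 \<in> {4, 6}" "d a0 a1 + d b0 b1 \<le> 10"
proof -
  show sum: "d a0 a1 + d b0 b1 \<le> 10"
    using square_gaps[of a0 b0 b1 a1] assms by (auto simp: domino_def)
  have "d a0 a1 = 4 \<or> d a0 a1 \<ge> 6"
    by (rule gap_ge_4[of a0 a1 b2 b0]) (use assms in \<open>auto simp: domino_def\<close>)
  moreover have "d b0 b1 = 4 \<or> d b0 b1 \<ge> 6"
    by (rule gap_ge_4[of b0 b1 a2 a0]) (use assms d_sym in \<open>auto simp: domino_def\<close>)
  ultimately show "d a0 a1 \<in> {4, 6}" "d b0 b1 \<in> {4, 6}" using sum by auto
qed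

text \<open>
  Geometrically, the path from \<open>a1\<close> to \<open>a2\<close> has three inner vertices. The leaf \<open>b0\<close> joins it
  in one of them, and not in the middle one, since \<open>b0\<close> has distance 5 from \<open>a1\<close> but not from
  \<open>a2\<close>. Next to \<open>a1\<close> would place \<open>b0\<close> too far from \<open>b1\<close>, so it joins next to \<open>a2\<close>. The
  values of the other distances follow.
\<close>

lemma domino_short_gap:
  assumes dom: "domino a0 a1 a2 b0 b1 b2" and short: "d a1 a2 = 4"
  shows "d a2 b0 = 3" "d b0 b1 = 6" "d a0 a1 = 4"
proof -
  have dist: "d a0 b0 = 5" "d a0 b1 = 5" "d a1 b0 = 5" "d a1 b1 = 5" "d a1 b2 = 5"
     "d a2 b1 = 5" "d a2 b2 = 5" "d a0 b2 \<noteq> 5" "d a2 b0 \<noteq> 5"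
    using dom by (auto simp: domino_def)
  note gaps = domino_gaps[OF dom]
  \<comment> \<open>Both sums competing with \<open>d b0 a2 + d b1 a1\<close> are at most 10. Together with the leaf
    condition and parity this leaves the values 3 and 5.\<close>
  have "d a2 b0 \<le> 5"
    using four_point[of b0 a2 b1 a1] dist short gaps d_sym[of b0 a2] d_sym[of b0 a1] d_sym[of b1 a1]
      d_sym[of a2 a1] by auto
  moreover have "d a2 b0 \<ge> 3"
    using leaf[of a2 a1 b0] dist short d_sym[of a2 a1] dom by (auto simp: domino_def)
  moreover have "odd (d a2 b0)" using parity[of a1 a2 b0] dist short by simp
  ultimately show ab: "d a2 b0 = 3" using dist(9) by presburger
  \<comment> \<open>Of the three sums over \<open>a1, a2, b0, b1\<close> two are now 8 and 10, so the third,
    \<open>d a1 a2 + d b0 b1\<close>, is 10.\<close>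
  show "d b0 b1 = 6"
    using four_point[of a1 b0 a2 b1] four_point[of a2 a1 b0 b1] four_point[of a2 b1 a1 b0]
     ab dist short gaps d_sym[of b0 a2] d_sym[of b0 a1] d_sym[of b1 a1]
      d_sym[of a2 a1] by auto
  then show "d a0 a1 = 4" using gaps by auto
qed

text \<open>
  The short gap of the middle square spreads to \<open>a0, a1\<close> in the first domino, and in the reversed
  second domino it makes \<open>d b2 b3 = 6\<close> and \<open>d a1 b3 = 3\<close>.
\<close>

lemma ladder_3_short_gap:
  assumes "domino a0 a1 a2 b0 b1 b2" "domino a1 a2 a3 b1 b2 b3" "d a1 a2 = 4"
  shows "d a0 b3 = 5"
proof -
  have a01: "d a0 a1 = 4" using domino_short_gap[OF assms(1,3)] by simp
  have a1b3: "d a1 b3 = 3" "d b3 b2 = 6"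
    using domino_short_gap[OF domino_rev[OF assms(2)]] assms(3) d_sym by auto
  have dist: "d a0 b1 = 5" "d a1 b1 = 5" "d a1 b2 = 5"
    using assms(1) by (auto simp: domino_def)
  have "d a0 b2 \<le> 5"
    using four_point[of a0 b2 a1 b1] a01 dist domino_gaps(2)[OF assms(2)] d_sym[of b2 b1] d_sym[of b2 a1]
    by auto
  \<comment> \<open>Now \<open>d a0 a1 + d b2 b3 = 10\<close> and \<open>d a0 b2 + d a1 b3 \<le> 8\<close>, so the remaining sum
    \<open>d a0 b3 + d a1 b2\<close> over these four points is 10 too.\<close>
  then show ?thesis
    using four_point[of a0 b3 a1 b2] four_point[of a0 a1 b2 b3] a01 a1b3 dist
      d_sym[of b3 b2] d_sym[of b3 a1] d_sym[of b2 a1] by auto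
qed

lemma no_ladder_3:
  assumes "domino a0 a1 a2 b0 b1 b2" "domino a1 a2 a3 b1 b2 b3" "d a0 b3 \<noteq> 5" "d b0 a3 \<noteq> 5"
  shows False
proof -
  have "d a1 a2 = 4 \<or> d b1 b2 = 4" using domino_gaps[OF assms(2)] by auto
  then show False
    using ladder_3_short_gap[OF assms(1,2)] assms(3,4)
      ladder_3_short_gap[OF domino_swap[OF assms(1)] domino_swap[OF assms(2)]] by blast
qed

end

lemma ladder_not_exact_5_leaf_power:
  assumes "t \<ge> 3"
  shows "\<not> exact_leaf_power 5 (ladder t)"
proof
  assume "exact_leaf_power 5 (ladder t)"
  then obtain T :: "(nat + nat) pair_pre_digraph"
    where T: "undirected_tree T" "leaves T = pverts (ladder t)"
    and adj: "\<And>u v. u \<in> pverts (ladder t) \<Longrightarrow> v \<in> pverts (ladder t) \<Longrightarrow> u \<noteq> v \<Longrightarrow>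
      (u, v) \<in> parcs (ladder t) \<longleftrightarrow> graph_dist T u v = ereal (real 5)"
    unfolding exact_leaf_power_def by blast
  obtain d where "leaf_metric (leaves T) d"
    and d: "\<And>u v. u \<in> pverts T \<Longrightarrow> v \<in> pverts T \<Longrightarrow> graph_dist T u v = ereal (real (d u v))"
    using undirected_tree_leaf_metric[OF T(1)] by metis
  then interpret leaf_metric "leaves T" d by simp
  have mem: "Inl i \<in> leaves T" "Inr i \<in> leaves T" if "i \<le> 3" for i
    using that assms by (auto simp: T(2) ladder_def)
  then have vert: "Inl i \<in> pverts T" "Inr i \<in> pverts T" if "i \<le> 3" for i
    using that by (auto simp: leaves_def)
  have xy: "d (Inl i) (Inr j) = 5 \<longleftrightarrow> \<bar>int i - int j\<bar> \<le> 1" if "i \<le> 3" "j \<le> 3" for i j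
    using adj[of "Inl i" "Inr j"] mem that d[of "Inl i" "Inr j"] vert assms
    by (auto simp: T(2) ladder_def)
  have "domino (Inl 0) (Inl 1) (Inl 2) (Inr 0) (Inr 1) (Inr 2)"
    "domino (Inl 1) (Inl 2) (Inl 3) (Inr 1) (Inr 2) (Inr 3)"
    unfolding domino_def by (auto simp: mem xy)
  moreover have "d (Inl 0) (Inr 3) \<noteq> 5" "d (Inr 0) (Inl 3) \<noteq> 5"
    using xy[of 0 3] xy[of 3 0] d_sym by auto
  ultimately show False by (rule no_ladder_3)
qed

section \<open>Explicit trees for the short ladders\<close>

definition attach_degree :: "('a \<times> 'a) list \<Rightarrow> 'a \<Rightarrow> nat" where
  "attach_degree es v = length (filter (\<lambda>(l, p). l = v \<or> p = v) es)"

lemma out_degree_attach_tree: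
  assumes "attachable r es"
  shows "out_degree (with_proj (attach_tree r es)) v = attach_degree es v"
proof -
  have "card {w. (v, w) \<in> set es \<union> (set es)\<inverse>} = attach_degree es v"
    using assms
  proof (induction es)
    case (Cons e es)
    obtain l p where e: "e = (l, p)" by (cases e)
    have fin: "finite {w. (v, w) \<in> set es \<union> (set es)\<inverse>}"
      by (rule finite_subset[of _ "fst ` set es \<union> snd ` set es"]) force+
    have new: "(l, w) \<notin> set es" "(w, l) \<notin> set es" for w
      using attachable_arc_vertices[of r es] Cons.prems by (auto simp: e)
    have "{w. (v, w) \<in> set (e # es) \<union> (set (e # es))\<inverse>} =
        (if v = l then {p} else if v = p then insert l {w. (v, w) \<in> set es \<union> (set es)\<inverse>}
         else {w. (v, w) \<in> set es \<union> (set es)\<inverse>})"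
      using Cons.prems new by (auto simp: e)
    moreover have "attach_degree es l = 0"
      using new by (auto simp: attach_degree_def filter_empty_conv)
    ultimately show ?case using Cons fin new by (auto simp: attach_degree_def e)
  qed (simp add: attach_degree_def)
  moreover have "out_arcs (with_proj (attach_tree r es)) v =
      Pair v ` {w. (v, w) \<in> set es \<union> (set es)\<inverse>}"
    by (auto simp: attach_tree_def)
  ultimately show ?thesis by (simp add: out_degree_def card_image inj_on_def)
qed

lemma exact_leaf_power_attach_treeI:
  fixes G :: "'a::infinite pair_pre_digraph"
  assumes es: "attachable r es"
    and lv: "{v \<in> insert r (fst ` set es). attach_degree es v = 1} = pverts G"
    and adj: "\<forall>u \<in> pverts G. \<forall>v \<in> pverts G. u \<noteq> v \<longrightarrow> ((u, v) \<in> parcs G \<longleftrightarrow> attach_dist es u v = k)"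
  shows "exact_leaf_power k G"
  unfolding exact_leaf_power_def
proof (intro exI conjI)
  have V: "pverts G \<subseteq> pverts (attach_tree r es)" using lv by (auto simp: attach_tree_def)
  show "undirected_tree (attach_tree r es)" by (rule undirected_tree_attach_tree[OF es])
  show "leaves (attach_tree r es) = pverts G"
    using lv by (simp add: leaves_def out_degree_attach_tree[OF es]) (simp add: attach_tree_def)
  show "\<forall>u \<in> pverts G. \<forall>v \<in> pverts G. u \<noteq> v \<longrightarrow>
      ((u, v) \<in> parcs G \<longleftrightarrow> graph_dist (attach_tree r es) u v = ereal (real k))"
    using adj V by (simp add: graph_dist_attach_tree[OF es] subset_iff)
qed

text \<open>
  A path with three edges, with both \<open>x\<close> attached to one end and both \<open>y\<close> to the other.
\<close>

lemma ladder_1_exact_5_leaf_power: "exact_leaf_power 5 (ladder 1)"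
proof (rule exact_leaf_power_attach_treeI)
  let ?es = "[(Inr 1, Inl 5), (Inr 0, Inl 5), (Inl 1, Inl 2), (Inl 0, Inl 2),
    (Inl 5, Inl 4), (Inl 4, Inl 3), (Inl 3, Inl 2)] :: ((nat + nat) \<times> (nat + nat)) list"
  have V: "pverts (ladder 1) = {Inl 0, Inl 1, Inr 0, Inr 1}"
    by (auto simp: ladder_def)
  show "attachable (Inl 2) ?es" by simp
  show "{v \<in> insert (Inl 2) (fst ` set ?es). attach_degree ?es v = 1} = pverts (ladder 1)"
    unfolding V by (auto simp: attach_degree_def)
  show "\<forall>u \<in> pverts (ladder 1). \<forall>v \<in> pverts (ladder 1). u \<noteq> v \<longrightarrow>
      ((u, v) \<in> parcs (ladder 1) \<longleftrightarrow> attach_dist ?es u v = 5)"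
    unfolding V by (simp add: ladder_def)
qed

text \<open>
  The hub \<open>Inl 3\<close> has distance 2 from each \<open>x\<close> and distance 3 from each \<open>y\<close>. Hence an
  \<open>x\<close> and a \<open>y\<close> have distance 5 unless they lie in the same branch at the hub. The leaves
  \<open>x\<^sub>2\<close> and \<open>y\<^sub>0\<close> share the branch of \<open>Inl 5\<close>, and \<open>x\<^sub>0\<close> and \<open>y\<^sub>2\<close> share that of
  \<open>Inl 8\<close>. These are the two pairs that are not edges, and their distance is 3.
\<close>

lemma ladder_2_exact_5_leaf_power: "exact_leaf_power 5 (ladder 2)"
proof (rule exact_leaf_power_attach_treeI)
  let ?es = "[(Inr 2, Inl 9), (Inr 1, Inl 7), (Inr 0, Inl 10),
    (Inl 2, Inl 5), (Inl 1, Inl 4), (Inl 0, Inl 8), (Inl 10, Inl 5), (Inl 9, Inl 8), (Inl 7, Inl 6),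
    (Inl 8, Inl 3), (Inl 6, Inl 3), (Inl 5, Inl 3), (Inl 4, Inl 3)]
     :: ((nat + nat) \<times> (nat + nat)) list"
  have V: "pverts (ladder 2) = {Inl 0, Inl 1, Inl 2, Inr 0, Inr 1, Inr 2}"
    by (auto simp: ladder_def)
  show "attachable (Inl 3) ?es" by simp
  show "{v \<in> insert (Inl 3) (fst ` set ?es). attach_degree ?es v = 1} = pverts (ladder 2)"
    unfolding V by (auto simp: attach_degree_def)
  show "\<forall>u \<in> pverts (ladder 2). \<forall>v \<in> pverts (ladder 2). u \<noteq> v \<longrightarrow>
      ((u, v) \<in> parcs (ladder 2) \<longleftrightarrow> attach_dist ?es u v = 5)"
    unfolding V by (simp add: ladder_def)
qed

section \<open>The ladders that are exact 5-leaf powers\<close>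

theorem theorem3p3:
  fixes t :: nat
  assumes "t \<ge> 1"
  shows "exact_leaf_power 5 (ladder t) \<longleftrightarrow> t \<le> 2"
proof
  assume "exact_leaf_power 5 (ladder t)"
  then show "t \<le> 2" using ladder_not_exact_5_leaf_power[of t] by linarith
next
  assume "t \<le> 2"
  then have "t = 1 \<or> t = 2" using assms by linarith
  then show "exact_leaf_power 5 (ladder t)"
    using ladder_1_exact_5_leaf_power ladder_2_exact_5_leaf_power by blast
qed

end
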